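(* The following assertion is false: for every infinite group $G$ and any disjoint subsets $A, B \subset G$, if $|A| < |G|$ and $|B| < |G|$, then $A$ and $B$ are separable in $G$. That is, there exist an infinite group $G$ and disjoint subsets $A, B \subset G$ with $|A| < |G|$ and $|B| < |G|$ such that $A$ and $B$ are not separable in $G$.
   Context: All arguments are in ZFC. Let $G$ be an infinite group with identity $e$, and let $A, B \subset G$ be disjoint subsets. We say $A$ and $B$ are separable in $G$ if there exists a subset $X \subset G$ such that (1) $X$ is infinite; (2) $e \in X$; (3) $X = X^{-1}$, i.e. $x \in X \Rightarrow x^{-1} \in X$; (4) $XAX \cap B = \varnothing$, where $XAX = \{x a x' : x, x' \in X,\ a \in A\}$. *)

theory Defs
  imports "HOL-Algebra.Coset" "HOL-Library.Equipollence"
begin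

definition separable :: "('a, 'b) monoid_scheme \<Rightarrow> 'a set \<Rightarrow> 'a set \<Rightarrow> bool" where
  "separable G A B \<longleftrightarrow>
     (\<exists>X \<subseteq> carrier G.
        infinite X \<and>
        \<one>\<^bsub>G\<^esub> \<in> X \<and>
        (\<forall>x\<in>X. inv\<^bsub>G\<^esub> x \<in> X) \<and>
        (X <#>\<^bsub>G\<^esub> A <#>\<^bsub>G\<^esub> X) \<inter> B = {})"

end

theory Submission
  imports Defs "HOL-Algebra.Bij" "HOL-Combinatorics.Transposition"
begin

text \<open>
  The counterexample is the symmetric group on \<open>\<nat>\<close>, which is uncountable. There
  \<open>A\<close> consists of the transpositions \<open>(i, i+1)\<close> and \<open>B\<close> of all the other transpositions, so both
  are countable. A transposition is an edge of the complete graph on \<open>\<nat>\<close>, and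
  conjugation by \<open>x\<close> moves the edge \<open>{i, j}\<close> to \<open>{x i, x j}\<close>; so \<open>A\<close> is the edge set of the
  one-way infinite path 0, 1, 2, \<dots> and \<open>B\<close> is the set of its non-edges.

  If \<open>X\<close> is closed under inverses and \<open>XAX\<close> misses \<open>B\<close>, then for each \<open>x\<close> in \<open>X\<close> both
  \<open>x A x\<inverse>\<close> and \<open>x\<inverse> A x\<close> consist of transpositions outside \<open>B\<close>, hence lie in \<open>A\<close>.
  Thus \<open>x\<close> is an automorphism of the path. The path is rigid: its origin is its only
  vertex with a single neighbour, so it is fixed, and then all other vertices are
  fixed one after another (lemma \<open>path_automorphism_trivial\<close>). Therefore \<open>X\<close> contains
  only the identity and cannot be infinite.
\<close>

section \<open>Rigidity of the one-way infinite path\<close>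

definition path_adjacent :: "nat \<Rightarrow> nat \<Rightarrow> bool" where
  "path_adjacent m n \<longleftrightarrow> m = Suc n \<or> n = Suc m"

text \<open>
  Adjacency under the inverse shows that the origin is fixed: a vertex
  \<open>x 0 > 0\<close> would have two neighbours, whose preimages would be distinct neighbours of 0. The rest is induction: the image of \<open>n + 1\<close> is a neighbour of \<open>n\<close>, and
  \<open>n - 1\<close> is already taken.
\<close>

lemma path_automorphism_trivial:
  assumes "bij x"
    and edge: "\<And>n. path_adjacent (x n) (x (Suc n))"
    and inv_edge: "\<And>n. path_adjacent (Hilbert_Choice.inv x n) (Hilbert_Choice.inv x (Suc n))"
  shows "x = id"
proof -
  have inv_x: "Hilbert_Choice.inv x (x n) = n" for n
    using assms(1) by (simp add: bij_is_inj)
  have origin: "x 0 = 0"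
  proof (rule ccontr)
    assume "x 0 \<noteq> 0"
    then obtain k where k: "x 0 = Suc k"
      using not0_implies_Suc by blast
    have "Hilbert_Choice.inv x (Suc k) = 0"
      using inv_x[of 0] k by simp
    then have "Hilbert_Choice.inv x k = 1" "Hilbert_Choice.inv x (Suc (Suc k)) = 1"
      using inv_edge[of k] inv_edge[of "Suc k"] by (auto simp: path_adjacent_def)
    then have "k = Suc (Suc k)"
      using assms(1) by (metis bij_inv_eq_iff)
    then show False by simp
  qed
  have "x n = n" for n
  proof (induction n rule: less_induct)
    case (less n)
    show ?case
    proof (cases n)
      case 0
      then show ?thesis using origin by simp
    next
      case (Suc m)
      have "x m = m" using less.IH[of m] Suc by simp
      then have "x n = Suc m \<or> m = Suc (x n)"
        using edge[of m] Suc by (auto simp: path_adjacent_def)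
      moreover have "m \<noteq> Suc (x n)"
      proof
        assume "m = Suc (x n)"
        then have "x (x n) = x n" using less.IH[of "x n"] Suc by simp
        then have "x n = n" using inv_x by metis
        then show False using \<open>m = Suc (x n)\<close> Suc by linarith
      qed
      ultimately show ?thesis using Suc by simp
    qed
  qed
  then show ?thesis by auto
qed

section \<open>Path edges and non-edges as transpositions\<close>

definition path_edges :: "(nat \<Rightarrow> nat) set" where
  "path_edges = {Transposition.transpose m n | m n. path_adjacent m n}"

definition path_non_edges :: "(nat \<Rightarrow> nat) set" where
  "path_non_edges = {Transposition.transpose m n | m n. m \<noteq> n \<and> \<not> path_adjacent m n}"

lemma path_edges_disjoint: "path_edges \<inter> path_non_edges = {}"
proof -
  have False if "Transposition.transpose i j = Transposition.transpose k l"
    and "path_adjacent i j" and "k \<noteq> l" "\<not> path_adjacent k l" for i j k l :: nat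
  proof -
    have "Transposition.transpose i j k = l" using that(1) by simp
    then have "k = i \<and> l = j \<or> k = j \<and> l = i"
      using that(3) by (auto simp: Transposition.transpose_def split: if_splits)
    then show False using that(2,4) by (auto simp: path_adjacent_def)
  qed
  then show ?thesis
    unfolding path_edges_def path_non_edges_def by blast
qed

lemma countable_transpositions:
  "countable {Transposition.transpose m n | m n :: nat. P m n}"
proof -
  have "{Transposition.transpose m n | m n :: nat. P m n}
      \<subseteq> range (\<lambda>(m, n). Transposition.transpose m n)"
    by auto
  then show ?thesis
    by (rule countable_subset) simp
qed

lemma conjugate_transpose:
  assumes "bij x"
  shows "x \<circ> Transposition.transpose m n \<circ> Hilbert_Choice.inv x = Transposition.transpose (x m) (x n)"
proof
  fix k
  show "(x \<circ> Transposition.transpose m n \<circ> Hilbert_Choice.inv x) k = Transposition.transpose (x m) (x n) k"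
    using assms transpose_apply_commute[of x "x m" "x n" "Hilbert_Choice.inv x k"]
    by (simp add: bij_is_inj bij_is_surj surj_f_inv_f)
qed

section \<open>The symmetric group on the natural numbers\<close>

lemma carrier_BijGroup_UNIV: "carrier (BijGroup UNIV) = {f. bij f}"
  by (simp add: BijGroup_def Bij_def extensional_def)

lemma mult_BijGroup_UNIV: "bij f \<Longrightarrow> bij g \<Longrightarrow> f \<otimes>\<^bsub>BijGroup UNIV\<^esub> g = f \<circ> g"
  by (auto simp: BijGroup_def Bij_def extensional_def compose_def)

lemma one_BijGroup_UNIV: "\<one>\<^bsub>BijGroup UNIV\<^esub> = id"
  by (auto simp: BijGroup_def)

lemma inv_BijGroup_UNIV:
  assumes "bij f"
  shows "inv\<^bsub>BijGroup UNIV\<^esub> f = Hilbert_Choice.inv f"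
proof (rule group.inv_equality[OF group_BijGroup])
  show "Hilbert_Choice.inv f \<otimes>\<^bsub>BijGroup UNIV\<^esub> f = \<one>\<^bsub>BijGroup UNIV\<^esub>"
    using assms by (simp add: mult_BijGroup_UNIV one_BijGroup_UNIV bij_imp_bij_inv bij_is_inj)
qed (use assms in \<open>auto simp: carrier_BijGroup_UNIV bij_imp_bij_inv\<close>)

text \<open>
  A set \<open>S\<close> of naturals is encoded by the involution that swaps \<open>2 n\<close> with \<open>2 n + 1\<close>
  exactly for the \<open>n\<close> in \<open>S\<close>; hence there are at least as many permutations as sets.
\<close>

lemma Pow_lepoll_permutations: "Pow (UNIV :: nat set) \<lesssim> {f :: nat \<Rightarrow> nat. bij f}"
proof -
  define swap :: "nat set \<Rightarrow> nat \<Rightarrow> nat" where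
    "swap S k = (if k div 2 \<in> S then if even k then Suc k else k - 1 else k)" for S k
  have "swap S (swap S k) = k" for S k
    by (auto simp: swap_def elim!: oddE)
  then have "bij (swap S)" for S
    by (intro o_bij[of "swap S"]) auto
  moreover have "inj swap"
  proof (rule inj_on_inverseI)
    show "{n. swap S (2 * n) = Suc (2 * n)} = S" for S
      by (simp add: swap_def)
  qed
  ultimately show ?thesis
    unfolding lepoll_def by (intro exI[of _ swap]) auto
qed

lemma countable_lesspoll_permutations:
  assumes "countable C"
  shows "C \<prec> {f :: nat \<Rightarrow> nat. bij f}"
proof -
  have "C \<lesssim> (UNIV :: nat set)"
    using assms unfolding countable_def lepoll_def by blast
  then show ?thesis
    by (rule lesspoll_trans1[OF _ lesspoll_trans2[OF lesspoll_Pow_self Pow_lepoll_permutations]])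
qed

text \<open>
  The products \<open>x a x\<inverse>\<close>, which lie in \<open>XAX\<close> because \<open>X\<close> is symmetric, already force
  every \<open>x\<close> in \<open>X\<close> to be an automorphism of the path.
\<close>

lemma path_not_separable: "\<not> separable (BijGroup UNIV) path_edges path_non_edges"
proof
  assume "separable (BijGroup UNIV) path_edges path_non_edges"
  then obtain X where X: "X \<subseteq> {f. bij f}" "infinite X"
    and X_inv: "\<And>x. x \<in> X \<Longrightarrow> inv\<^bsub>BijGroup UNIV\<^esub> x \<in> X"
    and disj: "(X <#>\<^bsub>BijGroup UNIV\<^esub> path_edges <#>\<^bsub>BijGroup UNIV\<^esub> X) \<inter> path_non_edges = {}"
    unfolding separable_def carrier_BijGroup_UNIV by blast
  have inv_in: "Hilbert_Choice.inv x \<in> X" if "x \<in> X" for x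
    using X_inv[OF that] inv_BijGroup_UNIV[of x] X(1) that by auto
  have edge: "path_adjacent (x n) (x (Suc n))" if "x \<in> X" for x n
  proof (rule ccontr)
    assume non_adjacent: "\<not> path_adjacent (x n) (x (Suc n))"
    let ?a = "Transposition.transpose n (Suc n)"
    have x: "bij x" using X that by blast
    have "?a \<in> path_edges"
      unfolding path_edges_def path_adjacent_def by blast
    then have "x \<otimes>\<^bsub>BijGroup UNIV\<^esub> ?a \<otimes>\<^bsub>BijGroup UNIV\<^esub> Hilbert_Choice.inv x
        \<in> X <#>\<^bsub>BijGroup UNIV\<^esub> path_edges <#>\<^bsub>BijGroup UNIV\<^esub> X"
      using that inv_in[OF that] unfolding set_mult_def by blast
    moreover have "x \<otimes>\<^bsub>BijGroup UNIV\<^esub> ?a \<otimes>\<^bsub>BijGroup UNIV\<^esub> Hilbert_Choice.inv x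
        = Transposition.transpose (x n) (x (Suc n))"
      using x by (simp add: mult_BijGroup_UNIV bij_imp_bij_inv bij_comp
          conjugate_transpose del: o_apply)
    moreover have "x n \<noteq> x (Suc n)"
      using x by (simp add: bij_is_inj inj_eq)
    then have "Transposition.transpose (x n) (x (Suc n)) \<in> path_non_edges"
      using non_adjacent unfolding path_non_edges_def by blast
    ultimately show False using disj by auto
  qed
  have "X \<subseteq> {id}"
  proof
    fix x assume "x \<in> X"
    then have "x = id"
      using X(1) edge inv_in by (intro path_automorphism_trivial) auto
    then show "x \<in> {id}" by simp
  qed
  then show False
    using X finite_subset by blast
qed

theorem theorem4p1:
  "\<exists>(G :: (nat \<Rightarrow> nat) monoid) A B.
     group G \<and> infinite (carrier G) \<and>
     A \<subseteq> carrier G \<and> B \<subseteq> carrier G \<and> A \<inter> B = {} \<and>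
     A \<prec> carrier G \<and> B \<prec> carrier G \<and>
     \<not> separable G A B"
proof (intro exI conjI)
  show "group (BijGroup (UNIV :: nat set))"
    by (rule group_BijGroup)
  show "infinite (carrier (BijGroup (UNIV :: nat set)))"
    using countable_lesspoll_permutations[OF countable_finite] lesspoll_not_refl
    unfolding carrier_BijGroup_UNIV by blast
  show "path_edges \<subseteq> carrier (BijGroup UNIV)" "path_non_edges \<subseteq> carrier (BijGroup UNIV)"
    by (auto simp: path_edges_def path_non_edges_def carrier_BijGroup_UNIV)
  show "path_edges \<inter> path_non_edges = {}"
    by (rule path_edges_disjoint)
  have "countable path_edges" "countable path_non_edges"
    using countable_transpositions[of path_adjacent]
      countable_transpositions[of "\<lambda>m n. m \<noteq> n \<and> \<not> path_adjacent m n"]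
    unfolding path_edges_def path_non_edges_def .
  then show "path_edges \<prec> carrier (BijGroup (UNIV :: nat set))"
    and "path_non_edges \<prec> carrier (BijGroup (UNIV :: nat set))"
    unfolding carrier_BijGroup_UNIV by (auto intro: countable_lesspoll_permutations)
  show "\<not> separable (BijGroup UNIV) path_edges path_non_edges"
    by (rule path_not_separable)
qed

end
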